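(* Let $X$ be a real $n\times p$ matrix of rank $p$, $p<n$, and let $V$ be a real symmetric non-negative definite non-zero $n\times n$ matrix of rank $k<n$. Consider the normal linear mixed model with two variance components $Y\sim N(X\beta,\ \sigma_1^2V+\sigma_2^2I_n)$. Let $M=I_n-XX^{+}$, let $B$ be any $(n-p)\times n$ matrix with $BB'=I_{n-p}$ and $B'B=M$, and let $d$ be the number of distinct eigenvalues of $BVB'$. If $$\mathcal M(MV)\subsetneq\mathcal M(M),$$ then the REML degree of the model does not exceed $2d-3$.
   Context: For a matrix $A$, $A'$ is its transpose, $A^{+}$ its Moore-Penrose inverse, $\mathcal M(A)$ its column space. The parameter $\beta\in\mathbb R^p$ is unknown, and the variance components are $s=(\sigma_1^2,\sigma_2^2)'$ with $\sigma_1^2\ge0$, $\sigma_2^2>0$. The eigenvalues of $BVB'$ do not depend on the choice of $B$. The condition $\mathcal M(MV)\subsetneq\mathcal M(M)$ is equivalent to $0$ being an eigenvalue of $BVB'$; the distinct eigenvalues of $BVB'$ are written $m_1>\dots>m_{d-1}>m_d=0$. The REML degree of the model is defined as the ML degree of the model $z\sim N(\mathbf 0_{n-p},\ \sigma_1^2BVB'+\sigma_2^2I_{n-p})$ for $z=BY$. With $U=BVB'$ and $\Omega=\sigma_1^2U+\sigma_2^2I_{n-p}$, the ML equations of that model (zero partial derivatives of $-\log|\Omega|-z'\Omega^{-1}z$ with respect to $\sigma_1^2$ and $\sigma_2^2$) are $$\operatorname{tr}(\Omega^{-1}U)=z'\Omega^{-1}U\Omega^{-1}z,\qquad \operatorname{tr}(\Omega^{-1})=z'\Omega^{-2}z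 .$$ A complex solution is a point $(\sigma_1^2,\sigma_2^2)\in\mathbb C^2$ with $\Omega$ invertible satisfying these equations. The REML degree is the number of complex solutions when the data are generic, i.e. outside an exceptional Lebesgue-null set. Thus "the REML degree does not exceed $N$" means that for Lebesgue-almost every $z\in\mathbb R^{n-p}$ the system has at most $N$ complex solutions.
   Formalization: The formal theorem additionally assumes d ≥ 2, i.e. BVB' ≠ 0; for d = 1 (e.g. n=2, p=1, X=e1, V=e1e1') the first variance component is unidentified, there are infinitely many solutions, and the bound 2d−3 = −1 is false. *)

theory Defs
  imports "HOL-Analysis.Analysis"
begin

definition is_moore_penrose :: "real^'n^'m \<Rightarrow> real^'m^'n \<Rightarrow> bool" where
  "is_moore_penrose A P \<longleftrightarrow>
     A ** P ** A = A \<and> P ** A ** P = P \<and>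
     transpose (A ** P) = A ** P \<and> transpose (P ** A) = P ** A"

definition moore_penrose :: "real^'n^'m \<Rightarrow> real^'m^'n" where
  "moore_penrose A = (THE P. is_moore_penrose A P)"

lemma is_moore_penrose_unique:
  fixes A :: "real^'n^'m"
  assumes P: "is_moore_penrose A P" and Q: "is_moore_penrose A Q"
  shows "P = Q"
proof -
  have AP: "A ** P = A ** Q"
  proof -
    have "A ** P = (A ** Q) ** (A ** P)"
      using Q by (simp add: is_moore_penrose_def matrix_mul_assoc)
    also have "\<dots> = transpose ((A ** P) ** (A ** Q))"
      using P Q by (simp add: is_moore_penrose_def matrix_transpose_mul)
    also have "(A ** P) ** (A ** Q) = A ** Q"
      using P by (simp add: is_moore_penrose_def matrix_mul_assoc)
    finally show ?thesis
      using Q by (simp add: is_moore_penrose_def)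
  qed
  have PA: "P ** A = Q ** A"
  proof -
    have "P ** A = (P ** A) ** (Q ** A)"
      using Q by (metis is_moore_penrose_def matrix_mul_assoc)
    also have "\<dots> = transpose ((Q ** A) ** (P ** A))"
      using P Q by (simp add: is_moore_penrose_def matrix_transpose_mul)
    also have "(Q ** A) ** (P ** A) = Q ** A"
      using P by (metis is_moore_penrose_def matrix_mul_assoc)
    finally show ?thesis
      using Q by (simp add: is_moore_penrose_def)
  qed
  have "P = P ** A ** P"
    using P by (simp add: is_moore_penrose_def)
  also have "\<dots> = Q ** A ** Q"
    by (metis AP PA matrix_mul_assoc)
  also have "\<dots> = Q"
    using Q by (simp add: is_moore_penrose_def)
  finally show ?thesis .
qed

lemma is_moore_penrose_full_column_rank:
  fixes A :: "real^'n^'m"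
  assumes "rank A = CARD('n)"
  shows "is_moore_penrose A (moore_penrose A)"
    and "moore_penrose A = matrix_inv (transpose A ** A) ** transpose A"
proof -
  let ?G = "transpose A ** A" and ?P = "matrix_inv (transpose A ** A) ** transpose A"
  have inj: "inj ((*v) A)"
    using assms full_rank_injective by blast
  have "v = 0" if "?G *v v = 0" for v
  proof -
    have "(A *v v) \<bullet> (A *v v) = v \<bullet> (?G *v v)"
      by (metis dot_lmul_matrix matrix_vector_mul_assoc transpose_matrix_vector transpose_transpose inner_commute)
    then have "A *v v = A *v 0"
      using that by simp
    then show "v = 0"
      using inj injD by metis
  qed
  then have "invertible ?G"
    by (simp add: invertible_left_inverse matrix_left_invertible_ker)
  then have "?G ** matrix_inv ?G = mat 1 \<and> matrix_inv ?G ** ?G = mat 1"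
    unfolding invertible_def matrix_inv_def by (rule someI_ex)
  then have G1: "matrix_inv ?G ** ?G = mat 1" and G2: "?G ** matrix_inv ?G = mat 1"
    by blast+
  have "transpose ?G = ?G"
    by (simp add: matrix_transpose_mul)
  then have "transpose (matrix_inv ?G) ** ?G = mat 1"
    using arg_cong[OF G2, of transpose] by (simp add: matrix_transpose_mul)
  then have "transpose (matrix_inv ?G) ** (?G ** matrix_inv ?G) = matrix_inv ?G"
    by (simp add: matrix_mul_assoc)
  then have Gt: "transpose (matrix_inv ?G) = matrix_inv ?G"
    by (simp add: G2)
  have PA: "?P ** A = mat 1"
    using G1 by (simp add: matrix_mul_assoc)
  have MP: "is_moore_penrose A ?P"
    unfolding is_moore_penrose_def
  proof (intro conjI)
    show "A ** ?P ** A = A"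
      using PA by (simp add: matrix_mul_assoc[symmetric])
    show "?P ** A ** ?P = ?P"
      using PA by simp
    show "transpose (A ** ?P) = A ** ?P"
      using Gt by (simp add: matrix_transpose_mul matrix_mul_assoc)
    show "transpose (?P ** A) = ?P ** A"
      using PA by simp
  qed
  have "moore_penrose A = ?P"
    unfolding moore_penrose_def
    by (rule the_equality, fact MP, rule is_moore_penrose_unique[OF _ MP])
  with MP show "is_moore_penrose A (moore_penrose A)" and "moore_penrose A = ?P"
    by simp_all
qed

definition column_space :: "real^'n^'m \<Rightarrow> (real^'m) set" where
  "column_space A = span (columns A)"

definition nonneg_definite :: "real^'n^'n \<Rightarrow> bool" where
  "nonneg_definite A \<longleftrightarrow> transpose A = A \<and> (\<forall>x. 0 \<le> x \<bullet> (A *v x))"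

text \<open>Real eigenvalues only; for the symmetric matrices considered here these are all the
  eigenvalues.\<close>

definition eigenvalues :: "real^'n^'n \<Rightarrow> real set" where
  "eigenvalues A = {m. \<exists>v. v \<noteq> 0 \<and> A *v v = m *s v}"

definition residual_projector :: "real^'p^'n \<Rightarrow> real^'n^'n" where
  "residual_projector X = mat 1 - X ** moore_penrose X"

text \<open>The covariance matrix \<open>s1 U + s2 I\<close> at complex parameters; \<open>mat s1 ** U\<close> is the scalar
  multiple \<open>s1 U\<close>, since \<^term>\<open>mat c\<close> is \<open>c\<close> times the identity.\<close>

definition complex_cov :: "real^'q^'q \<Rightarrow> complex \<Rightarrow> complex \<Rightarrow> complex^'q^'q" where
  "complex_cov U s1 s2 = mat s1 ** map_matrix complex_of_real U + mat s2"

text \<open>The complex solutions of the ML equations of the model \<open>z \<sim> N(0, s1 U + s2 I)\<close>, which state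
  that both partial derivatives of \<open>- log |\<Omega>| - z' \<Omega>\<inverse> z\<close> vanish.  The quadratic forms are extended
  algebraically to complex \<open>\<Omega>\<close>, without conjugation, hence \<^const>\<open>scalar_product\<close> and not the
  inner product.\<close>

definition ml_solutions :: "real^'q^'q \<Rightarrow> real^'q \<Rightarrow> (complex \<times> complex) set" where
  "ml_solutions U z = {(s1, s2).
     let W = complex_cov U s1 s2;
         Wi = matrix_inv W;
         Uc = map_matrix complex_of_real U;
         zc = (\<chi> i. complex_of_real (z $ i))
     in invertible W \<and>
        trace (Wi ** Uc) = scalar_product zc ((Wi ** Uc ** Wi) *v zc) \<and>
        trace Wi = scalar_product zc ((Wi ** Wi) *v zc)}"

definition ml_degree_le :: "real^'q^'q \<Rightarrow> nat \<Rightarrow> bool" where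
  "ml_degree_le U N \<longleftrightarrow>
     (AE z in (lborel :: (real^'q) measure).
        finite (ml_solutions U z) \<and> card (ml_solutions U z) \<le> N)"

text \<open>The REML degree of \<open>Y \<sim> N(X \<beta>, s1 V + s2 I)\<close> is the ML degree of the model of \<open>z = B Y\<close>, where
  \<open>B B' = I\<close> and \<open>B' B\<close> is the residual projector of \<open>X\<close>; the design matrix enters only through
  \<open>B\<close>.\<close>

definition reml_degree_le :: "real^'n^'n \<Rightarrow> real^'n^'q \<Rightarrow> nat \<Rightarrow> bool" where
  "reml_degree_le V B N \<longleftrightarrow> ml_degree_le (B ** V ** transpose B) N"

end

theory Submission
  imports Defs "HOL-Computational_Algebra.Polynomial"
begin

text \<open>In an orthonormal eigenbasis of \<open>U = B V B'\<close>, with eigenvalues \<open>\<mu>\<^sub>i\<close> and data coordinates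
  \<open>y\<^sub>i\<close>, put \<open>T\<^sub>i = y\<^sub>i\<^sup>2\<close>, \<open>q = n - p\<close> and \<open>r = s\<^sub>1 / s\<^sub>2\<close>; the ratio is legitimate because \<open>0\<close> is an
  eigenvalue, which makes \<open>s\<^sub>2\<close> itself an eigenvalue of the invertible \<open>\<Omega>\<close>.  The combination of the
  two ML equations with coefficients \<open>s\<^sub>1, s\<^sub>2\<close> gives \<open>q s\<^sub>2 = \<Sum> T\<^sub>i / (1 + r \<mu>\<^sub>i)\<close>, so a solution is
  determined by \<open>r\<close>, and eliminating \<open>s\<^sub>2\<close> leaves
  \<open>(\<Sum> T\<^sub>i / (1 + r \<mu>\<^sub>i)) (\<Sum> \<mu>\<^sub>i / (1 + r \<mu>\<^sub>i)) = q (\<Sum> \<mu>\<^sub>i T\<^sub>i / (1 + r \<mu>\<^sub>i)\<^sup>2)\<close>.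
  Multiplied by the square of the product of \<open>1 + r m\<close> over the \<open>d - 1\<close> nonzero eigenvalues \<open>m\<close>, this
  is a polynomial equation in \<open>r\<close>: the left side has degree exactly \<open>(d - 1) + (d - 2) = 2 d - 3\<close>
  as soon as the data vector is not orthogonal to the kernel of \<open>U\<close>, and the right side has degree at
  most \<open>2 d - 4\<close>.\<close>

section \<open>Spectral theorem for self-adjoint maps\<close>

lemma linear_coefficient_zero_if_nonneg:
  fixes a b :: real
  assumes nonneg: "\<And>t. 0 \<le> a * t + b * t\<^sup>2" and "0 \<le> b"
  shows "a = 0"
proof -
  \<comment> \<open>The test point is near the minimiser of the parabola; dividing by
    \<open>b + 1\<close> instead of \<open>2 * b\<close> also covers \<open>b = 0\<close> and still
    makes the value minus a square.\<close>
  have "a * (- a / (b + 1)) + b * (- a / (b + 1))\<^sup>2 = - (a / (b + 1))\<^sup>2"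
    using \<open>0 \<le> b\<close> by (simp add: divide_simps power2_eq_square) (simp add: algebra_simps)
  then have "(a / (b + 1))\<^sup>2 \<le> 0"
    using nonneg[of "- a / (b + 1)"] by simp
  then show ?thesis
    using \<open>0 \<le> b\<close> by auto
qed

text \<open>A maximiser \<open>v\<close> of the Rayleigh quotient on the compact unit sphere of
  \<open>S\<close> is an eigenvector, and its maximal value \<open>c\<close> is the eigenvalue:
  otherwise moving from \<open>v\<close> along the residual \<open>c *\<^sub>R v - f v\<close> would
  increase the quotient. Working inside an invariant subspace allows eigenvectors to be split off
  one at a time.\<close>

lemma self_adjoint_unit_eigenvector:
  fixes f :: "'a::euclidean_space \<Rightarrow> 'a"
  assumes lin: "linear f" and self: "\<And>x y. f x \<bullet> y = x \<bullet> f y"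
    and S: "subspace S" and inv: "\<And>x. x \<in> S \<Longrightarrow> f x \<in> S" and u: "u \<in> S" "u \<noteq> 0"
  obtains v c where "v \<in> S" "norm v = 1" "f v = c *\<^sub>R v"
proof -
  let ?K = "sphere 0 1 \<inter> S"
  have "compact ?K"
    by (simp add: compact_Int_closed closed_subspace S)
  moreover have "u /\<^sub>R norm u \<in> ?K"
    using u S by (simp add: subspace_scale)
  moreover have "continuous_on ?K (\<lambda>x. x \<bullet> f x)"
    by (intro continuous_intros linear_continuous_on) (simp add: lin linear_conv_bounded_linear[symmetric])
  ultimately obtain v where v: "v \<in> ?K" and max: "\<And>x. x \<in> ?K \<Longrightarrow> x \<bullet> f x \<le> v \<bullet> f v"
    using continuous_attains_sup[of ?K "\<lambda>x. x \<bullet> f x"] by blast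
  define c where "c = v \<bullet> f v"
  have bound: "w \<bullet> f w \<le> c * (w \<bullet> w)" if "w \<in> S" for w
  proof (cases "w = 0")
    case False
    have "w /\<^sub>R norm w \<in> ?K"
      using that False S by (simp add: subspace_scale)
    from max[OF this] have "(w \<bullet> f w) / (norm w)\<^sup>2 \<le> c"
      using False by (simp add: linear_cmul[OF lin] c_def power2_eq_square field_simps)
    then show ?thesis
      using False by (simp add: divide_le_eq power2_norm_eq_inner)
  qed (simp add: linear_0[OF lin])
  define w where "w = c *\<^sub>R v - f v"
  have "w \<in> S"
    using v S inv by (auto simp: w_def intro: subspace_diff subspace_scale)
  \<comment> \<open>The gap \<open>c * (x \<bullet> x) - x \<bullet> f x\<close> is nonnegative on
    \<open>S\<close> and vanishes at \<open>v\<close>. Along \<open>v + t *\<^sub>R w\<close> its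
    linear coefficient is twice the squared length of the residual, so the residual must be
    zero.\<close>
  have "0 \<le> 2 * (w \<bullet> w) * t + (c * (w \<bullet> w) - w \<bullet> f w) * t\<^sup>2" for t
  proof -
    have "v + t *\<^sub>R w \<in> S"
      using v \<open>w \<in> S\<close> S by (auto intro: subspace_add subspace_scale)
    from bound[OF this]
    have "0 \<le> c * ((v + t *\<^sub>R w) \<bullet> (v + t *\<^sub>R w)) - (v + t *\<^sub>R w) \<bullet> f (v + t *\<^sub>R w)"
      by simp
    also have "\<dots> = c * (v \<bullet> v) - v \<bullet> f v + 2 * t * (c * (v \<bullet> w) - f v \<bullet> w)
        + (c * (w \<bullet> w) - w \<bullet> f w) * t\<^sup>2"
      using self[of v w]
      by (simp add: linear_add[OF lin] linear_cmul[OF lin] inner_simps power2_eq_square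
          inner_commute[of w v] inner_commute[of w "f v"] algebra_simps)
    also have "c * (v \<bullet> v) - v \<bullet> f v = 0"
      using v by (simp add: c_def norm_eq_1)
    also have "c * (v \<bullet> w) - f v \<bullet> w = w \<bullet> w"
      using inner_diff_left[of "c *\<^sub>R v" "f v" w] by (simp add: w_def[symmetric])
    finally show ?thesis
      by (simp add: algebra_simps)
  qed
  from linear_coefficient_zero_if_nonneg[OF this] have "w = 0"
    using bound[OF \<open>w \<in> S\<close>] by simp
  then show thesis
    using that[of v c] v by (simp add: w_def)
qed

text \<open>Take an orthonormal set of eigenvectors of greatest cardinality; independence bounds the
  cardinality by the dimension. If it did not span, self-adjointness would make its orthogonal
  complement invariant, and a unit eigenvector found there would enlarge the set.\<close>

lemma self_adjoint_orthonormal_eigenbasis: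
  fixes f :: "'a::euclidean_space \<Rightarrow> 'a"
  assumes lin: "linear f" and self: "\<And>x y. f x \<bullet> y = x \<bullet> f y"
  obtains B where "pairwise orthogonal B" "\<And>b. b \<in> B \<Longrightarrow> norm b = 1"
    "\<And>b. b \<in> B \<Longrightarrow> \<exists>c. f b = c *\<^sub>R b" "finite B" "card B = DIM('a)"
proof -
  define ok where "ok B \<longleftrightarrow> pairwise orthogonal B \<and> (\<forall>b\<in>B. norm b = 1 \<and> (\<exists>c. f b = c *\<^sub>R b))"
    for B :: "'a set"
  have indep: "independent B" if "ok B" for B
    using that by (intro pairwise_orthogonal_independent) (auto simp: ok_def)
  have "ok {}"
    by (simp add: ok_def)
  moreover have "\<forall>B. ok B \<longrightarrow> card B < Suc (DIM('a))"
    using indep independent_bound by (auto simp: less_Suc_eq_le)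
  ultimately obtain B where B: "ok B" and max: "\<And>C. ok C \<Longrightarrow> card C \<le> card B"
    using ex_has_greatest_nat[of ok "{}" card "Suc (DIM('a))"] by auto
  have fin: "finite B" and card: "card B = dim (span B)"
    using indep[OF B] by (simp_all add: independent_imp_finite dim_eq_card_independent)
  have "dim (span B) = DIM('a)"
  proof (rule ccontr)
    assume "dim (span B) \<noteq> DIM('a)"
    then have "dim B < DIM('a)"
      using dim_subset_UNIV[of B] by simp
    then obtain u where u: "u \<noteq> 0" "\<And>x. x \<in> span B \<Longrightarrow> orthogonal u x"
      using orthogonal_to_subspace_exists by blast
    let ?S = "{y. \<forall>b\<in>B. orthogonal b y}"
    have "u \<in> ?S"
      using u span_base orthogonal_commute by blast
    have inv: "f x \<in> ?S" if x: "x \<in> ?S" for x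
    proof clarify
      fix b assume "b \<in> B"
      moreover from this B obtain c where "f b = c *\<^sub>R b"
        by (auto simp: ok_def)
      ultimately show "orthogonal b (f x)"
        using x self[of b x] by (simp add: orthogonal_def)
    qed
    obtain v c where v: "v \<in> ?S" "norm v = 1" "f v = c *\<^sub>R v"
      by (rule self_adjoint_unit_eigenvector[OF lin self subspace_orthogonal_to_vectors inv
            \<open>u \<in> ?S\<close> \<open>u \<noteq> 0\<close>])
    have "v \<notin> B"
      using v by (metis (no_types, lifting) mem_Collect_eq norm_zero orthogonal_self zero_neq_one)
    moreover have "ok (insert v B)"
      using B v by (auto simp: ok_def pairwise_insert orthogonal_commute)
    ultimately show False
      using max[of "insert v B"] fin by simp
  qed
  with B fin card show thesis
    using that[of B] by (auto simp: ok_def)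
qed

section \<open>Diagonal matrices and orthogonal diagonalization\<close>

definition diag_matrix :: "('n::finite \<Rightarrow> 'a::zero) \<Rightarrow> 'a^'n^'n" where
  "diag_matrix c = (\<chi> i j. if i = j then c i else 0)"

lemma diag_matrix_mult_vector: "diag_matrix c *v x = (\<chi> i. c i * x $ i)"
  by (simp add: diag_matrix_def matrix_vector_mult_def vec_eq_iff
      if_distribR if_distrib[where f = "\<lambda>a. a * b" for b] cong: if_cong)

lemma diag_matrix_mult: "diag_matrix a ** diag_matrix b = diag_matrix (\<lambda>i. a i * b i)"
  by (simp add: diag_matrix_def matrix_matrix_mult_def vec_eq_iff
      if_distrib[where f = "\<lambda>a. a * b" for b] cong: if_cong)

lemma trace_diag_matrix: "trace (diag_matrix c) = (\<Sum>i\<in>UNIV. c i)"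
  by (simp add: trace_def diag_matrix_def)

lemma det_diag_matrix:
  fixes c :: "'n::finite \<Rightarrow> 'a::comm_ring_1"
  shows "det (diag_matrix c) = (\<Prod>i\<in>UNIV. c i)"
  by (subst det_diagonal) (simp_all add: diag_matrix_def)

lemma diag_matrix_const: "diag_matrix (\<lambda>i. c) = mat c"
  by (simp add: diag_matrix_def mat_def)

text \<open>The orthonormal eigenbasis, indexed by \<open>'n\<close> through a bijection, supplies
  the columns of \<open>P\<close>; the eigenvector equations then read
  \<open>U ** P = P ** diag_matrix \<mu>\<close>.\<close>

theorem symmetric_matrix_diagonalization:
  fixes U :: "real^'n^'n"
  assumes sym: "transpose U = U"
  obtains P \<mu> where "orthogonal_matrix P" "U = P ** diag_matrix \<mu> ** transpose P"
proof -
  have self: "(U *v x) \<bullet> y = x \<bullet> (U *v y)" for x y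
    using dot_lmul_matrix[of x U y] transpose_matrix_vector[of U x] sym by simp
  obtain B where B: "pairwise orthogonal B" "\<And>b. b \<in> B \<Longrightarrow> norm b = 1"
    "\<And>b. b \<in> B \<Longrightarrow> \<exists>c. U *v b = c *\<^sub>R b" "finite B" "card B = CARD('n)"
    by (rule self_adjoint_orthonormal_eigenbasis[OF matrix_vector_mul_linear[of U] self])
      (simp add: that)
  obtain f :: "'n \<Rightarrow> real^'n" where f: "bij_betw f UNIV B"
    using finite_same_card_bij[of "UNIV :: 'n set" B] B by auto
  have fB: "f i \<in> B" for i
    using f by (simp add: bij_betwE)
  then have "\<forall>i. \<exists>c. U *v f i = c *\<^sub>R f i"
    using B(3) by blast
  then obtain \<mu> where \<mu>: "\<And>i. U *v f i = \<mu> i *\<^sub>R f i"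
    by metis
  define P :: "real^'n^'n" where "P = (\<chi> i j. f j $ i)"
  have col: "column j P = f j" for j
    by (simp add: P_def column_def vec_eq_iff)
  have P: "orthogonal_matrix P"
    unfolding orthogonal_matrix_orthonormal_columns col
  proof (intro conjI allI impI)
    fix i j :: 'n
    show "norm (f i) = 1"
      by (simp add: B(2) fB)
    show "orthogonal (f i) (f j)" if "i \<noteq> j"
      using that bij_betw_imp_inj_on[OF f] by (auto intro: pairwiseD[OF B(1) fB fB] dest: injD)
  qed
  have "(U ** P) $ k $ j = (P ** diag_matrix \<mu>) $ k $ j" for k j
  proof -
    have "(U ** P) $ k $ j = (U *v f j) $ k"
      by (simp add: matrix_matrix_mult_def matrix_vector_mult_def P_def)
    also have "\<dots> = (P ** diag_matrix \<mu>) $ k $ j"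
      unfolding \<mu>
      by (simp add: matrix_matrix_mult_def P_def diag_matrix_def if_distrib[where f = "\<lambda>a. b * a" for b] cong: if_cong)
    finally show ?thesis .
  qed
  then have "U ** P = P ** diag_matrix \<mu>"
    by (simp add: vec_eq_iff)
  then have "U = P ** diag_matrix \<mu> ** transpose P"
    using P by (metis matrix_mul_assoc matrix_mul_rid orthogonal_matrix_def)
  with P show thesis
    by (rule that)
qed

text \<open>In the coordinates \<open>transpose P *v v\<close>, any nonzero entry of an eigenvector
  forces its eigenvalue to be the diagonal entry there. Since \<open>range \<mu>\<close> forgets
  multiplicities, its cardinality is the number \<open>d\<close> of distinct eigenvalues.\<close>

lemma eigenvalues_diagonalization:
  fixes P :: "real^'n^'n"
  assumes P: "orthogonal_matrix P"
  shows "eigenvalues (P ** diag_matrix \<mu> ** transpose P) = range \<mu>"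
proof -
  have PP: "P ** transpose P = mat 1" "transpose P ** P = mat 1"
    using P by (simp_all add: orthogonal_matrix_def)
  let ?U = "P ** diag_matrix \<mu> ** transpose P"
  have "\<exists>i. m = \<mu> i" if "v \<noteq> 0" "?U *v v = m *s v" for m v
  proof -
    let ?w = "transpose P *v v"
    have "P *v ?w = v"
      by (simp add: matrix_vector_mul_assoc PP del: transpose_matrix_vector)
    with that(1) have "?w \<noteq> 0"
      by auto
    then obtain i where i: "?w $ i \<noteq> 0"
      by (auto simp: vec_eq_iff)
    have "transpose P *v (?U *v v) = diag_matrix \<mu> *v ?w"
      by (simp add: matrix_vector_mul_assoc matrix_mul_assoc PP del: transpose_matrix_vector)
    then have "m *s ?w = diag_matrix \<mu> *v ?w"
      unfolding that(2) by (simp add: vec.scale del: transpose_matrix_vector)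
    then show ?thesis
      using i by (auto simp: diag_matrix_mult_vector vec_eq_iff)
  qed
  moreover have "\<exists>v. v \<noteq> 0 \<and> ?U *v v = \<mu> i *s v" for i
  proof (intro exI conjI)
    let ?e = "axis i 1 :: real^'n"
    have "transpose P *v (P *v ?e) = ?e"
      by (simp add: matrix_vector_mul_assoc PP del: transpose_matrix_vector)
    then show "P *v ?e \<noteq> 0"
      by (metis axis_eq_0_iff matrix_vector_mult_0_right zero_neq_one)
    have "?U *v (P *v ?e) = P *v (diag_matrix \<mu> *v (transpose P *v (P *v ?e)))"
      by (simp only: matrix_vector_mul_assoc matrix_mul_assoc)
    also have "\<dots> = P *v (diag_matrix \<mu> *v ?e)"
      by (simp add: matrix_vector_mul_assoc PP del: transpose_matrix_vector)
    also have "diag_matrix \<mu> *v ?e = \<mu> i *s ?e"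
      by (auto simp: diag_matrix_mult_vector vec_eq_iff axis_def)
    finally show "?U *v (P *v ?e) = \<mu> i *s (P *v ?e)"
      by (simp add: vec.scale)
  qed
  ultimately show ?thesis
    by (auto simp: eigenvalues_def) blast
qed

section \<open>The ML equations in eigencoordinates over the complex numbers\<close>

abbreviation (input) complex_matrix :: "real^'n^'m \<Rightarrow> complex^'n^'m" where
  "complex_matrix \<equiv> map_matrix complex_of_real"

lemma complex_matrix_mult: "complex_matrix (A ** B) = complex_matrix A ** complex_matrix B"
  by (simp add: matrix_matrix_mult_def vec_eq_iff)

lemma complex_matrix_transpose: "complex_matrix (transpose A) = transpose (complex_matrix A)"
  by (simp add: transpose_def vec_eq_iff)

lemma complex_matrix_diag: "complex_matrix (diag_matrix c) = diag_matrix (\<lambda>i. of_real (c i))"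
  by (simp add: diag_matrix_def vec_eq_iff)

lemma complex_matrix_mat: "complex_matrix (mat c) = mat (of_real c)"
  by (simp add: mat_def vec_eq_iff)

lemma matrix_inv_eq:
  fixes A :: "'a::semiring_1^'n^'m"
  assumes "A ** A' = mat 1" "A' ** A = mat 1"
  shows "matrix_inv A = A'"
proof -
  have "A ** matrix_inv A = mat 1 \<and> matrix_inv A ** A = mat 1"
    unfolding matrix_inv_def by (rule someI[of _ A']) (simp add: assms)
  then have left: "matrix_inv A ** A = mat 1" ..
  have "matrix_inv A = matrix_inv A ** (A ** A')"
    by (simp add: assms(1))
  also have "\<dots> = A'"
    by (simp add: left matrix_mul_assoc)
  finally show ?thesis .
qed

text \<open>All matrices in the equations are diagonal in the same real eigenbasis, so traces and
  quadratic forms become sums over eigenvalues. The complexified \<open>P\<close> satisfies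
  \<open>Q ** transpose Q = mat 1\<close> without conjugation, which fits the bilinear
  \<open>scalar_product\<close>.\<close>

lemma ml_solutions_diagonalization:
  fixes P :: "real^'q^'q"
  assumes P: "orthogonal_matrix P"
    and sol: "(s1, s2) \<in> ml_solutions (P ** diag_matrix \<mu> ** transpose P) z"
  defines "\<omega> \<equiv> \<lambda>i. s1 * of_real (\<mu> i) + s2"
    and "T \<equiv> \<lambda>i. (complex_of_real ((transpose P *v z) $ i))\<^sup>2"
  shows "\<forall>i. \<omega> i \<noteq> 0"
    and "(\<Sum>i\<in>UNIV. of_real (\<mu> i) / \<omega> i) = (\<Sum>i\<in>UNIV. of_real (\<mu> i) * T i / (\<omega> i)\<^sup>2)"
    and "(\<Sum>i\<in>UNIV. 1 / \<omega> i) = (\<Sum>i\<in>UNIV. T i / (\<omega> i)\<^sup>2)"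
proof -
  define Q where "Q = complex_matrix P"
  define zc :: "complex^'q" where "zc = (\<chi> i. of_real (z $ i))"
  \<comment> \<open>\<open>conj c\<close> is conjugation by \<open>Q\<close>, not complex
    conjugation: the matrix with eigenvalues \<open>c i\<close> in the fixed eigenbasis. Sums and
    products of such matrices are computed entrywise, and constant \<open>c\<close> gives scalar
    matrices.\<close>
  define conj where "conj c = Q ** diag_matrix c ** transpose Q" for c
  have "P ** transpose P = mat 1" "transpose P ** P = mat 1"
    using P by (simp_all add: orthogonal_matrix_def)
  from this[THEN arg_cong[of _ _ complex_matrix]]
  have QQ: "Q ** transpose Q = mat 1" "transpose Q ** Q = mat 1"
    by (simp_all add: complex_matrix_mult complex_matrix_transpose complex_matrix_mat Q_def)
  have U: "complex_matrix (P ** diag_matrix \<mu> ** transpose P) = conj (\<lambda>i. of_real (\<mu> i))"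
    by (simp add: complex_matrix_mult complex_matrix_transpose complex_matrix_diag Q_def conj_def)
  have conj_mult: "conj a ** conj b = conj (\<lambda>i. a i * b i)" for a b
  proof -
    have "conj a ** conj b = Q ** diag_matrix a ** (transpose Q ** Q) ** diag_matrix b ** transpose Q"
      by (simp only: conj_def matrix_mul_assoc)
    also have "\<dots> = Q ** (diag_matrix a ** diag_matrix b) ** transpose Q"
      by (simp add: QQ matrix_mul_assoc)
    finally show ?thesis
      by (simp add: conj_def diag_matrix_mult)
  qed
  have conj_add: "conj a + conj b = conj (\<lambda>i. a i + b i)" for a b
  proof -
    have "diag_matrix (\<lambda>i. a i + b i) = diag_matrix a + diag_matrix b"
      by (simp add: diag_matrix_def vec_eq_iff)
    then show ?thesis
      by (simp add: conj_def matrix_matrix_mult_def vec_eq_iff distrib_left distrib_right sum.distrib)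
  qed
  have conj_const: "conj (\<lambda>i. c) = mat c" for c
  proof -
    have "Q ** mat c = mat c ** Q"
      by (simp add: matrix_matrix_mult_def mat_def vec_eq_iff if_distrib[where f = "\<lambda>a. b * a" for b]
          if_distrib[where f = "\<lambda>a. a * b" for b] cong: if_cong)
    then show ?thesis
      by (simp add: conj_def diag_matrix_const QQ flip: matrix_mul_assoc)
  qed
  have trace: "trace (conj c) = (\<Sum>i\<in>UNIV. c i)" for c
    by (simp add: conj_def trace_mul_sym[of _ "transpose Q"] matrix_mul_assoc QQ trace_diag_matrix)
  have Qz: "(transpose Q *v zc) $ i = of_real ((transpose P *v z) $ i)" for i
    by (simp add: Q_def zc_def matrix_vector_mult_def transpose_def del: transpose_matrix_vector)
  have quad: "scalar_product zc (conj c *v zc) = (\<Sum>i\<in>UNIV. c i * T i)" for c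
  proof -
    have "scalar_product x (Q *v y) = scalar_product (transpose Q *v x) y" for x y
      unfolding scalar_product_def matrix_vector_mult_def transpose_def
      by (simp add: sum_distrib_left sum_distrib_right mult_ac, subst sum.swap) (rule refl)
    then have "scalar_product zc (conj c *v zc) =
        scalar_product (transpose Q *v zc) (diag_matrix c *v (transpose Q *v zc))"
      by (simp add: conj_def matrix_mul_assoc matrix_vector_mul_assoc[symmetric] del: transpose_matrix_vector)
    also have "\<dots> = (\<Sum>i\<in>UNIV. c i * T i)"
      by (simp add: scalar_product_def diag_matrix_mult_vector Qz T_def power2_eq_square mult_ac
          del: transpose_matrix_vector)
    finally show ?thesis .
  qed
  have W: "complex_cov (P ** diag_matrix \<mu> ** transpose P) s1 s2 = conj \<omega>"
    unfolding complex_cov_def U \<omega>_def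
    by (simp add: conj_mult conj_add flip: conj_const)
  have "invertible (conj \<omega>)"
    using sol by (simp add: ml_solutions_def W Let_def)
  then have "det (conj \<omega>) \<noteq> 0"
    by (simp add: invertible_det_nz)
  then show nz: "\<forall>i. \<omega> i \<noteq> 0"
    by (auto simp: conj_def det_mul det_diag_matrix)
  then have Wi: "matrix_inv (conj \<omega>) = conj (\<lambda>i. 1 / \<omega> i)"
    by (intro matrix_inv_eq) (simp_all add: conj_mult conj_const)
  have eqs: "trace (conj (\<lambda>i. 1 / \<omega> i) ** conj (\<lambda>i. of_real (\<mu> i))) =
      scalar_product zc ((conj (\<lambda>i. 1 / \<omega> i) ** conj (\<lambda>i. of_real (\<mu> i)) ** conj (\<lambda>i. 1 / \<omega> i)) *v zc)"
    "trace (conj (\<lambda>i. 1 / \<omega> i)) = scalar_product zc ((conj (\<lambda>i. 1 / \<omega> i) ** conj (\<lambda>i. 1 / \<omega> i)) *v zc)"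
    using sol by (simp_all add: ml_solutions_def W Wi U Let_def zc_def)
  from eqs(1)
  show "(\<Sum>i\<in>UNIV. of_real (\<mu> i) / \<omega> i) = (\<Sum>i\<in>UNIV. of_real (\<mu> i) * T i / (\<omega> i)\<^sup>2)"
    by (simp add: conj_mult trace quad power2_eq_square)
  from eqs(2)
  show "(\<Sum>i\<in>UNIV. 1 / \<omega> i) = (\<Sum>i\<in>UNIV. T i / (\<omega> i)\<^sup>2)"
    by (simp add: conj_mult trace quad power2_eq_square)
qed

section \<open>Reduction to one polynomial equation in the variance ratio\<close>

lemma ml_equations_ratio:
  fixes \<mu> T :: "'i::finite \<Rightarrow> complex" and s1 s2 :: complex
  defines "\<omega> \<equiv> \<lambda>i. s1 * \<mu> i + s2" and "a \<equiv> \<lambda>i. 1 + s1 / s2 * \<mu> i"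
  assumes nz: "\<And>i. \<omega> i \<noteq> 0" and "s2 \<noteq> 0"
    and eq1: "(\<Sum>i\<in>UNIV. \<mu> i / \<omega> i) = (\<Sum>i\<in>UNIV. \<mu> i * T i / (\<omega> i)\<^sup>2)"
    and eq2: "(\<Sum>i\<in>UNIV. 1 / \<omega> i) = (\<Sum>i\<in>UNIV. T i / (\<omega> i)\<^sup>2)"
  shows "of_nat CARD('i) * s2 = (\<Sum>i\<in>UNIV. T i / a i)"
    and "(\<Sum>i\<in>UNIV. T i / a i) * (\<Sum>i\<in>UNIV. \<mu> i / a i) =
      of_nat CARD('i) * (\<Sum>i\<in>UNIV. \<mu> i * T i / (a i)\<^sup>2)"
proof -
  have \<omega>: "\<omega> i = s2 * a i" for i
    using \<open>s2 \<noteq> 0\<close> by (simp add: \<omega>_def a_def field_simps)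
  with nz have a: "a i \<noteq> 0" for i
    by (metis mult_zero_right)
  \<comment> \<open>Adding \<open>s1\<close> times the first equation and \<open>s2\<close> times
    the second puts \<open>\<omega> i\<close> in every numerator: each summand on the left becomes
    1, and one factor \<open>\<omega> i\<close> cancels on the right.\<close>
  have "of_nat CARD('i) = (\<Sum>i\<in>(UNIV::'i set). (s1 * \<mu> i + s2) / \<omega> i)"
    using nz by (simp add: \<omega>_def)
  also have "\<dots> = s1 * (\<Sum>i\<in>UNIV. \<mu> i / \<omega> i) + s2 * (\<Sum>i\<in>UNIV. 1 / \<omega> i)"
    by (simp add: add_divide_distrib sum.distrib sum_distrib_left)
  also have "\<dots> = (\<Sum>i\<in>UNIV. (s1 * \<mu> i + s2) * T i / (\<omega> i)\<^sup>2)"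
    unfolding eq1 eq2
    by (simp add: add_divide_distrib sum.distrib sum_distrib_left ring_distribs mult.assoc)
  also have "\<dots> = (\<Sum>i\<in>UNIV. T i / \<omega> i)"
    using nz by (simp add: \<omega>_def power2_eq_square)
  also have "\<dots> = (\<Sum>i\<in>UNIV. T i / a i) / s2"
    by (simp add: \<omega> sum_divide_distrib mult.commute)
  finally show s2: "of_nat CARD('i) * s2 = (\<Sum>i\<in>UNIV. T i / a i)"
    using \<open>s2 \<noteq> 0\<close> by (simp add: field_simps)
  \<comment> \<open>The first equation is rescaled by the square of \<open>s2\<close>; the remaining
    factor \<open>s2\<close> is then replaced by means of the identity just proved.\<close>
  have "(\<Sum>i\<in>UNIV. \<mu> i / a i) = s2 * (\<Sum>i\<in>UNIV. \<mu> i / \<omega> i)"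
    using \<open>s2 \<noteq> 0\<close> by (simp add: \<omega> sum_distrib_left)
  also have "\<dots> * s2 = (\<Sum>i\<in>UNIV. \<mu> i * T i / (a i)\<^sup>2)"
    unfolding eq1 using \<open>s2 \<noteq> 0\<close>
    by (simp add: \<omega> sum_distrib_left sum_distrib_right power2_eq_square)
  finally show "(\<Sum>i\<in>UNIV. T i / a i) * (\<Sum>i\<in>UNIV. \<mu> i / a i) =
      of_nat CARD('i) * (\<Sum>i\<in>UNIV. \<mu> i * T i / (a i)\<^sup>2)"
    by (simp add: mult_ac flip: s2)
qed

text \<open>Excluding 0 from \<open>N\<close> gives every factor degree exactly 1, so degrees add
  and leading coefficients multiply.\<close>

lemma prod_linear_poly_coeff:
  fixes N :: "real set"
  assumes "finite N" "0 \<notin> N"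
  shows "degree (\<Prod>j\<in>N. [:1, complex_of_real j:]) = card N"
    and "coeff (\<Prod>j\<in>N. [:1, complex_of_real j:]) (card N) = of_real (\<Prod>N)"
proof -
  have "degree [:1, complex_of_real j:] = 1" if "j \<in> N" for j
    using that assms by auto
  then show deg: "degree (\<Prod>j\<in>N. [:1, complex_of_real j:]) = card N"
    by (subst degree_prod_sum_eq) simp_all
  have "lead_coeff [:1, complex_of_real j:] = of_real j" if "j \<in> N" for j
    using that assms by auto
  then show "coeff (\<Prod>j\<in>N. [:1, complex_of_real j:]) (card N) = of_real (\<Prod>N)"
    using lead_coeff_prod[of "\<lambda>j. [:1, complex_of_real j:]" N] by (simp add: deg)
qed

text \<open>After clearing denominators, the sign conditions on \<open>\<mu>\<close> and
  \<open>T\<close> rule out cancellation in the two leading coefficients on the left side. Their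
  product survives because the right side has smaller degree, so the polynomial is nonzero.\<close>

lemma profile_equation_polynomial:
  fixes \<mu> T :: "'i::finite \<Rightarrow> real"
  assumes \<mu>: "\<And>i. 0 \<le> \<mu> i" and T: "\<And>i. 0 \<le> T i"
    and i0: "\<mu> i0 = 0" "T i0 > 0" and d: "2 \<le> card (range \<mu>)"
  obtains p :: "complex poly" where "p \<noteq> 0" "degree p \<le> 2 * card (range \<mu>) - 3"
    "\<And>r. (\<And>i. 1 + r * of_real (\<mu> i) \<noteq> 0) \<Longrightarrow>
      (\<Sum>i\<in>UNIV. of_real (T i) / (1 + r * of_real (\<mu> i))) *
        (\<Sum>i\<in>UNIV. of_real (\<mu> i) / (1 + r * of_real (\<mu> i))) =
      of_nat CARD('i) * (\<Sum>i\<in>UNIV. of_real (\<mu> i) * of_real (T i) / (1 + r * of_real (\<mu> i))\<^sup>2) \<Longrightarrow>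
      poly p r = 0"
proof -
  define N where "N = range \<mu> - {0}"
  \<comment> \<open>\<open>N\<close> has \<open>d - 1\<close> elements, so \<open>e\<close> is
    \<open>d - 2\<close> and the target bound \<open>2 * d - 3\<close> is
    \<open>2 * e + 1\<close>.\<close>
  define e where "e = card N - 1"
  \<comment> \<open>\<open>R x\<close> is the common denominator with the factor of \<open>x\<close>
    removed. As 0 is not in \<open>N\<close>, \<open>R 0\<close> is the full product and has one
    degree more than the others.\<close>
  define R where "R x = (\<Prod>j\<in>N - {x}. [:1, complex_of_real j:])" for x
  define c where "c x = \<Prod>(N - {x})" for x
  have fin: "finite N"
    by (simp add: N_def)
  have "0 \<in> range \<mu>"
    using i0 by (metis rangeI)
  then have card: "card (range \<mu>) = Suc (card N)"
    unfolding N_def by (simp add: card_Diff_singleton card_gt_0_iff)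
  then have cardN: "card N = Suc e"
    using d by (simp add: e_def)
  have c: "c x > 0" for x
    unfolding c_def using \<mu> by (intro prod_pos) (auto simp: N_def less_le)
  have RN: "degree (R x) = e" "coeff (R x) e = of_real (c x)" if "x \<in> N" for x
  proof -
    have "card (N - {x}) = e"
      using that cardN fin by simp
    then show "degree (R x) = e" "coeff (R x) e = of_real (c x)"
      using prod_linear_poly_coeff[of "N - {x}"] fin by (auto simp: R_def c_def N_def)
  qed
  have R0: "degree (R 0) = Suc e" "coeff (R 0) (Suc e) = of_real (c 0)"
    using prod_linear_poly_coeff[of N] fin cardN by (auto simp: R_def c_def N_def)
  have \<mu>N: "\<mu> i \<in> N" if "\<mu> i \<noteq> 0" for i
    using that by (simp add: N_def)
  obtain i1 where i1: "\<mu> i1 \<noteq> 0"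
    using cardN by (force simp: N_def dest: card_eq_SucD)
  define p1 where "p1 = (\<Sum>i\<in>UNIV. smult (of_real (T i)) (R (\<mu> i)))"
  define p2 where "p2 = (\<Sum>i\<in>UNIV. smult (of_real (\<mu> i)) (R (\<mu> i)))"
  define p3 where "p3 = (\<Sum>i\<in>UNIV. smult (of_real (\<mu> i) * of_real (T i)) ((R (\<mu> i))\<^sup>2))"
  define p where "p = p1 * p2 - smult (of_nat CARD('i)) p3"
  \<comment> \<open>Only indices with \<open>\<mu> i = 0\<close> reach degree \<open>Suc e\<close>;
    their contribution is positive thanks to \<open>T i0 > 0\<close>.\<close>
  have "coeff p1 (Suc e) = of_real (\<Sum>i\<in>UNIV. if \<mu> i = 0 then T i * c 0 else 0)"
    unfolding p1_def coeff_sum of_real_sum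
  proof (intro sum.cong refl)
    fix i
    show "coeff (smult (of_real (T i)) (R (\<mu> i))) (Suc e) = of_real (if \<mu> i = 0 then T i * c 0 else 0)"
      using R0 RN[OF \<mu>N, of i] by (cases "\<mu> i = 0") (simp_all add: coeff_eq_0)
  qed
  moreover have "(\<Sum>i\<in>UNIV. if \<mu> i = 0 then T i * c 0 else 0) > 0"
    using T c[of 0] i0 by (intro sum_pos2[of _ i0]) (auto intro: mult_nonneg_nonneg less_imp_le)
  ultimately have p1: "coeff p1 (Suc e) \<noteq> 0"
    by (auto simp only: of_real_eq_0_iff less_irrefl)
  have "degree (smult (of_real (T i)) (R (\<mu> i))) \<le> Suc e" for i
    using R0 RN[OF \<mu>N, of i] by (cases "\<mu> i = 0") (auto intro: order_trans[OF degree_smult_le])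
  then have p1': "degree p1 = Suc e"
    using p1 by (intro antisym le_degree) (auto simp: p1_def intro!: degree_sum_le)
  \<comment> \<open>Here the weight \<open>\<mu> i\<close> removes exactly the summands with the
    longer polynomial \<open>R 0\<close>, so the degree drops to \<open>e\<close>. The same weight
    keeps \<open>p3\<close> within degree \<open>2 * e\<close>.\<close>
  have "coeff p2 e = of_real (\<Sum>i\<in>UNIV. \<mu> i * c (\<mu> i))"
    unfolding p2_def coeff_sum of_real_sum
  proof (intro sum.cong refl)
    fix i
    show "coeff (smult (of_real (\<mu> i)) (R (\<mu> i))) e = of_real (\<mu> i * c (\<mu> i))"
      using RN[OF \<mu>N, of i] by (cases "\<mu> i = 0") simp_all
  qed
  moreover have "(\<Sum>i\<in>UNIV. \<mu> i * c (\<mu> i)) > 0"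
    using \<mu> c i1 by (intro sum_pos2[of _ i1]) (auto intro: mult_nonneg_nonneg mult_pos_pos simp: less_le)
  ultimately have p2: "coeff p2 e \<noteq> 0"
    by (auto simp only: of_real_eq_0_iff less_irrefl)
  have "degree (smult (of_real (\<mu> i)) (R (\<mu> i))) \<le> e" for i
    using RN[OF \<mu>N, of i] by (cases "\<mu> i = 0") auto
  then have p2': "degree p2 = e"
    using p2 by (intro antisym le_degree) (auto simp: p2_def intro!: degree_sum_le)
  have "degree (smult (of_real (\<mu> i) * of_real (T i)) ((R (\<mu> i))\<^sup>2)) \<le> 2 * e" for i
    using RN(1)[OF \<mu>N, of i] degree_power_le[of "R (\<mu> i)" 2]
    by (cases "\<mu> i = 0") (auto intro: order_trans[OF degree_smult_le])
  then have p3': "degree p3 \<le> 2 * e"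
    by (auto simp: p3_def intro!: degree_sum_le)
  \<comment> \<open>The degree of \<open>p3\<close> is at most \<open>2 * e\<close>, one short of
    the position inspected.\<close>
  have "coeff p (Suc e + e) = coeff p1 (Suc e) * coeff p2 e"
    using coeff_mult_degree_sum[of p1 p2] p1' p2' p3' by (simp add: p_def coeff_eq_0)
  then have "p \<noteq> 0"
    using p1 p2 by auto
  moreover have "degree p \<le> 2 * card (range \<mu>) - 3"
  proof -
    have "degree p \<le> Suc (2 * e)"
      unfolding p_def using p1' p2' p3' degree_mult_le[of p1 p2]
      by (intro degree_diff_le) (auto intro: order_trans[OF degree_smult_le])
    then show ?thesis
      by (simp add: card cardN)
  qed
  moreover have "poly p r = 0"
    if nz: "\<And>i. 1 + r * of_real (\<mu> i) \<noteq> 0"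
      and eq: "(\<Sum>i\<in>UNIV. of_real (T i) / (1 + r * of_real (\<mu> i))) *
        (\<Sum>i\<in>UNIV. of_real (\<mu> i) / (1 + r * of_real (\<mu> i))) =
      of_nat CARD('i) * (\<Sum>i\<in>UNIV. of_real (\<mu> i) * of_real (T i) / (1 + r * of_real (\<mu> i))\<^sup>2)" for r
  proof -
    define A where "A = (\<Prod>j\<in>N. 1 + r * complex_of_real j)"
    \<comment> \<open>For a zero eigenvalue the denominator is 1 and no factor is removed, so the
      formula is uniform in \<open>i\<close>.\<close>
    have R: "poly (R (\<mu> i)) r = A / (1 + r * of_real (\<mu> i))" for i
    proof (cases "\<mu> i = 0")
      case True
      then show ?thesis
        by (simp add: R_def A_def N_def poly_prod)
    next
      case False
      then show ?thesis
        using nz[of i] fin \<mu>N[of i] by (simp add: R_def A_def poly_prod prod.remove[of N "\<mu> i"])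
    qed
    have "poly p r = A\<^sup>2 * ((\<Sum>i\<in>UNIV. of_real (T i) / (1 + r * of_real (\<mu> i))) *
        (\<Sum>i\<in>UNIV. of_real (\<mu> i) / (1 + r * of_real (\<mu> i))) -
      of_nat CARD('i) * (\<Sum>i\<in>UNIV. of_real (\<mu> i) * of_real (T i) / (1 + r * of_real (\<mu> i))\<^sup>2))"
    proof -
      have "poly p1 r = A * (\<Sum>i\<in>UNIV. of_real (T i) / (1 + r * of_real (\<mu> i)))"
        by (simp add: p1_def poly_sum R sum_distrib_left mult_ac)
      moreover have "poly p2 r = A * (\<Sum>i\<in>UNIV. of_real (\<mu> i) / (1 + r * of_real (\<mu> i)))"
        by (simp add: p2_def poly_sum R sum_distrib_left mult_ac)
      moreover have "poly p3 r =
          A\<^sup>2 * (\<Sum>i\<in>UNIV. of_real (\<mu> i) * of_real (T i) / (1 + r * of_real (\<mu> i))\<^sup>2)"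
        by (simp add: p3_def poly_sum R sum_distrib_left power_divide mult_ac)
      ultimately show ?thesis
        by (simp add: p_def power2_eq_square algebra_simps)
    qed
    then show ?thesis
      using eq by simp
  qed
  ultimately show thesis
    by (rule that)
qed

section \<open>Counting solutions for almost all data\<close>

lemma AE_lborel_inner_nonzero:
  fixes v :: "'a::euclidean_space"
  assumes "v \<noteq> 0"
  shows "AE z in lborel. v \<bullet> z \<noteq> 0"
proof -
  have "negligible {z. v \<bullet> z = 0}"
    using assms by (intro negligible_hyperplane) simp
  moreover have "{z. v \<bullet> z = 0} \<in> sets lborel"
    by (simp add: closed_hyperplane)
  ultimately have "{z. v \<bullet> z = 0} \<in> null_sets lborel"
    by (simp add: negligible_iff_null_sets null_sets_completion_iff)
  from AE_not_in[OF this] show ?thesis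
    by simp
qed

text \<open>Each solution is recovered from its ratio \<open>s1 / s2\<close>, a root of the nonzero
  polynomial above, so there are at most as many solutions as its degree.\<close>

lemma card_ml_solutions_le:
  fixes P :: "real^'q^'q"
  assumes P: "orthogonal_matrix P" and \<mu>: "\<And>i. 0 \<le> \<mu> i"
    and i0: "\<mu> i0 = 0" "(transpose P *v z) $ i0 \<noteq> 0" and d: "2 \<le> card (range \<mu>)"
  defines "S \<equiv> ml_solutions (P ** diag_matrix \<mu> ** transpose P) z"
  shows "finite S \<and> card S \<le> 2 * card (range \<mu>) - 3"
proof -
  define T where "T i = ((transpose P *v z) $ i)\<^sup>2" for i
  have "0 \<le> T i" "0 < T i0" for i
    using i0 by (simp_all add: T_def del: transpose_matrix_vector)
  from profile_equation_polynomial[of \<mu> T, OF \<mu> this(1) i0(1) this(2) d]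
  obtain p :: "complex poly" where p: "p \<noteq> 0" "degree p \<le> 2 * card (range \<mu>) - 3"
    and root: "\<And>r. (\<And>i. 1 + r * of_real (\<mu> i) \<noteq> 0) \<Longrightarrow>
      (\<Sum>i\<in>UNIV. of_real (T i) / (1 + r * of_real (\<mu> i))) *
        (\<Sum>i\<in>UNIV. of_real (\<mu> i) / (1 + r * of_real (\<mu> i))) =
      of_nat CARD('q) * (\<Sum>i\<in>UNIV. of_real (\<mu> i) * of_real (T i) / (1 + r * of_real (\<mu> i))\<^sup>2) \<Longrightarrow>
      poly p r = 0"
    by blast
  \<comment> \<open>\<open>h r\<close> is the value of \<open>s2\<close> dictated by the ratio
    \<open>r\<close>. At a root of \<open>p\<close> where a denominator vanishes it may be
    meaningless, which is harmless: only the inclusion of \<open>S\<close> in the image is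
    claimed.\<close>
  define h where "h r = (\<Sum>i\<in>UNIV. of_real (T i) / (1 + r * of_real (\<mu> i))) / of_nat CARD('q)"
    for r :: complex
  have "(s1, s2) \<in> (\<lambda>r. (r * h r, h r)) ` {r. poly p r = 0}" if "(s1, s2) \<in> S" for s1 s2
  proof -
    note sol = ml_solutions_diagonalization[OF P that[unfolded S_def]]
    have nz: "s1 * of_real (\<mu> i) + s2 \<noteq> 0" for i
      using sol(1) by blast
    \<comment> \<open>At the zero eigenvalue, \<open>\<omega> i0\<close> is \<open>s2\<close>
      itself.\<close>
    from nz[of i0] have "s2 \<noteq> 0"
      by (simp add: i0)
    note ratio = ml_equations_ratio[of s1 "\<lambda>i. of_real (\<mu> i)" s2 "\<lambda>i. of_real (T i)",
        OF nz this, OF sol(2,3)[folded of_real_power, folded T_def]]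
    have "1 + s1 / s2 * of_real (\<mu> i) = (s1 * of_real (\<mu> i) + s2) / s2" for i
      using \<open>s2 \<noteq> 0\<close> by (simp add: field_simps)
    then have "1 + s1 / s2 * of_real (\<mu> i) \<noteq> 0" for i
      using nz[of i] \<open>s2 \<noteq> 0\<close> by simp
    then have "poly p (s1 / s2) = 0"
      using ratio(2) by (intro root)
    moreover have "h (s1 / s2) = s2"
      unfolding h_def ratio(1)[symmetric] by simp
    ultimately show ?thesis
      using \<open>s2 \<noteq> 0\<close> by (intro image_eqI[of _ _ "s1 / s2"]) simp_all
  qed
  then have sub: "S \<subseteq> (\<lambda>r. (r * h r, h r)) ` {r. poly p r = 0}"
    by auto
  have fin: "finite {r. poly p r = 0}"
    using p(1) by (rule poly_roots_finite)
  have "card S \<le> card {r. poly p r = 0}"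
    using sub fin by (meson card_image_le card_mono finite_imageI order_trans)
  also have "\<dots> \<le> degree p"
    using p(1) by (rule card_poly_roots_bound)
  finally show ?thesis
    using p(2) finite_subset[OF sub] fin by auto
qed

lemma ml_degree_le_singular:
  fixes U :: "real^'q^'q"
  assumes U: "nonneg_definite U" and 0: "0 \<in> eigenvalues U" and d: "2 \<le> card (eigenvalues U)"
  shows "ml_degree_le U (2 * card (eigenvalues U) - 3)"
proof -
  obtain P \<mu> where P: "orthogonal_matrix P" and U_eq: "U = P ** diag_matrix \<mu> ** transpose P"
    using symmetric_matrix_diagonalization U unfolding nonneg_definite_def by blast
  have eig: "eigenvalues U = range \<mu>"
    unfolding U_eq by (rule eigenvalues_diagonalization[OF P])
  have \<mu>: "0 \<le> \<mu> i" for i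
  proof -
    have "\<mu> i \<in> eigenvalues U"
      by (simp add: eig)
    then obtain v where v: "v \<noteq> 0" "U *v v = \<mu> i *s v"
      by (auto simp: eigenvalues_def)
    then have "0 \<le> \<mu> i * (v \<bullet> v)"
      using U by (metis nonneg_definite_def inner_scaleR_right scalar_mult_eq_scaleR)
    then show ?thesis
      using v(1) mult_neg_pos[of "\<mu> i" "v \<bullet> v"] by fastforce
  qed
  obtain i0 where i0: "\<mu> i0 = 0"
    using 0 eig by auto
  \<comment> \<open>The exceptional null set is the hyperplane of data orthogonal to
    \<open>column i0 P\<close>, a unit vector in the kernel of \<open>U\<close>.\<close>
  have "norm (column i0 P) = 1"
    using P by (simp add: orthogonal_matrix_orthonormal_columns)
  then have "column i0 P \<noteq> 0"
    by auto
  from AE_lborel_inner_nonzero[OF this]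
  have "AE z in lborel. (transpose P *v z) $ i0 \<noteq> 0"
    by (simp add: matrix_vector_mult_def transpose_def column_def inner_vec_def del: transpose_matrix_vector)
  then show ?thesis
    unfolding ml_degree_le_def eig unfolding U_eq
    by (rule AE_mp) (use card_ml_solutions_le[of P \<mu> i0, OF P \<mu> i0] d eig in auto)
qed

section \<open>From the column space condition to the zero eigenvalue\<close>

lemma column_space_eq_range:
  fixes A :: "real^'n^'m"
  shows "column_space A = range ((*v) A)"
proof (intro equalityI subsetI)
  show "x \<in> range ((*v) A)" if "x \<in> column_space A" for x
  proof -
    have "columns A \<subseteq> range ((*v) A)"
      by (auto simp: columns_def simp flip: matrix_vector_mult_basis)
    moreover have "subspace (range ((*v) A))"
      by (simp add: linear_subspace_image)
    ultimately show ?thesis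
      using that span_minimal[of "columns A"] unfolding column_space_def by blast
  qed
qed (auto simp: column_space_def matrix_vector_mult_in_columnspace)

text \<open>If \<open>U = B V B'\<close> had an inverse \<open>U'\<close>, then
  \<open>B' B x = B' U U' B x = (B' B V) (B' U' B x)\<close> for every \<open>x\<close>. The column
  space of \<open>B' B\<close> would thus lie in that of \<open>B' B V\<close>; the reverse
  inclusion is automatic, so the two would coincide.\<close>

lemma zero_eigenvalue_compressed:
  fixes B :: "real^'n^'q" and V :: "real^'n^'n"
  assumes B: "B ** transpose B = mat 1"
    and sub: "column_space (transpose B ** B ** V) \<noteq> column_space (transpose B ** B)"
  shows "0 \<in> eigenvalues (B ** V ** transpose B)"
proof (rule ccontr)
  let ?U = "B ** V ** transpose B"
  assume "0 \<notin> eigenvalues ?U"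
  then have "\<forall>v. ?U *v v = 0 \<longrightarrow> v = 0"
    by (auto simp: eigenvalues_def)
  then obtain U' where "U' ** ?U = mat 1"
    by (auto simp flip: matrix_left_invertible_ker)
  then have U': "?U ** U' = mat 1"
    by (simp add: matrix_left_right_inverse)
  have "range ((*v) (transpose B ** B)) \<subseteq> range ((*v) (transpose B ** B ** V))"
  proof clarify
    fix x
    have "(transpose B ** B) *v x = transpose B *v ((?U ** U') *v (B *v x))"
      by (simp add: U' matrix_vector_mul_assoc del: transpose_matrix_vector)
    also have "\<dots> = (transpose B ** B ** V) *v (transpose B *v (U' *v (B *v x)))"
      by (simp only: matrix_vector_mul_assoc matrix_mul_assoc)
    finally show "(transpose B ** B) *v x \<in> range ((*v) (transpose B ** B ** V))"
      by (rule range_eqI)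
  qed
  moreover have "range ((*v) (transpose B ** B ** V)) \<subseteq> range ((*v) (transpose B ** B))"
    by (auto simp flip: matrix_vector_mul_assoc[of "transpose B ** B"])
  ultimately show False
    using sub by (simp add: column_space_eq_range)
qed

lemma nonneg_definite_congruence:
  fixes B :: "real^'n^'q"
  assumes "nonneg_definite V"
  shows "nonneg_definite (B ** V ** transpose B)"
proof -
  have "transpose (B ** V ** transpose B) = B ** V ** transpose B"
    using assms by (simp add: nonneg_definite_def matrix_transpose_mul matrix_mul_assoc)
  moreover have "0 \<le> x \<bullet> ((B ** V ** transpose B) *v x)" for x
  proof -
    have "x \<bullet> ((B ** V ** transpose B) *v x) = (transpose B *v x) \<bullet> (V *v (transpose B *v x))"
      using dot_lmul_matrix[of x B "V *v (transpose B *v x)"]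
      by (simp add: matrix_mul_assoc flip: matrix_vector_mul_assoc)
    then show ?thesis
      using assms by (simp add: nonneg_definite_def)
  qed
  ultimately show ?thesis
    by (simp add: nonneg_definite_def)
qed

theorem theorem4p2:
  fixes X :: "real^'p^'n" and V M :: "real^'n^'n" and B :: "real^'n^'q" and d :: nat
  assumes "rank X = CARD('p)" and "CARD('p) < CARD('n)"
    and "nonneg_definite V" and "V \<noteq> 0" and "rank V < CARD('n)"
    and "M = residual_projector X"
    and "CARD('q) = CARD('n) - CARD('p)"
    and "B ** transpose B = mat 1" and "transpose B ** B = M"
    and "d = card (eigenvalues (B ** V ** transpose B))"
    and "2 \<le> d"
    and "column_space (M ** V) \<subset> column_space M"
  shows "reml_degree_le V B (2 * d - 3)"
proof -
  have "0 \<in> eigenvalues (B ** V ** transpose B)"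
    using assms(8,9,12) by (intro zero_eigenvalue_compressed) auto
  \<comment> \<open>Since \<open>2 \<le> d\<close>, the natural-number subtraction in
    \<open>2 * d - 3\<close> is not truncated.\<close>
  then show ?thesis
    unfolding reml_degree_le_def assms(10)
    using assms(3,10,11) by (intro ml_degree_le_singular nonneg_definite_congruence) simp_all
qed

end
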